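(* Let $m\ge n\ge 1$ be integers, let $A\in\mathbb{R}^{m\times m}$ and $B\in\mathbb{R}^{n\times n}$ be symmetric matrices, and let $\rho>0$. Let $F(X)=\mathrm{tr}(X^TAXB)$, and let $\mathcal{X}\subset \mathrm{St}(m,n)$ be the set of critical points of $F$ on $\mathrm{St}(m,n)$. Then there exist constants $\delta,\eta>0$ such that $$\mathrm{dist}(X,\mathcal{X})\le \eta\,\|D_\rho(X)\|_F\quad\text{whenever } X\in \mathrm{St}(m,n)\text{ and } \mathrm{dist}(X,\mathcal{X})\le\delta .$$
   Context: $\mathrm{St}(m,n)=\{X\in\mathbb{R}^{m\times n} : X^TX=I_n\}$ is the Stiefel manifold, viewed as an embedded submanifold of $\mathbb{R}^{m\times n}$ with the inherited metric $\langle X,Y\rangle=\mathrm{tr}(X^TY)$; $\|\cdot\|_F$ is the Frobenius norm. For a non-empty closed set $\mathcal{X}\subset\mathbb{R}^{m\times n}$, $\mathrm{dist}(Y,\mathcal{X})=\min_{X\in\mathcal{X}}\|X-Y\|_F$. The Euclidean gradient of $F$ is $\nabla F(X)=2AXB$. For $X\in \mathrm{St}(m,n)$, the orthogonal projection of $\nabla F(X)$ onto the tangent space $\{Y\in\mathbb{R}^{m\times n}: X^TY+Y^TX=0\}$ is $$\mathrm{grad}\,F(X)=2AXB-XX^TAXB-XBX^TAX,$$ and the set of critical points is $\mathcal{X}=\{X\in \mathrm{St}(m,n): \mathrm{grad}\,F(X)=0\}$. For $\rho>0$, $$D_\rho(X)=\nabla F(X)-X\left(2\rho\,\nabla F(X)^TX+(1-2\rho)X^T\nabla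 F(X)\right).$$ *)

theory Defs
  imports "HOL-Analysis.Analysis"
begin

text \<open>An \<open>m \<times> n\<close> real matrix has type \<open>real^'n^'m\<close>, with \<open>m = CARD('m)\<close> and \<open>n = CARD('n)\<close>.
  The library's inner product and norm on this type are the trace inner product and the
  Frobenius norm:\<close>

lemma inner_eq_trace:
  fixes X Y :: "real^'n^'m"
  shows "inner X Y = trace (transpose X ** Y)"
proof -
  have "inner X Y = (\<Sum>i\<in>UNIV. \<Sum>j\<in>UNIV. X$i$j * Y$i$j)"
    by (simp add: inner_vec_def)
  also have "\<dots> = (\<Sum>j\<in>UNIV. \<Sum>i\<in>UNIV. X$i$j * Y$i$j)"
    by (rule sum.swap)
  finally show ?thesis
    by (simp add: trace_def matrix_matrix_mult_def transpose_def)
qed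

lemma norm_eq_frobenius:
  fixes X :: "real^'n^'m"
  shows "norm X = sqrt (trace (transpose X ** X))"
  by (simp add: norm_eq_sqrt_inner inner_eq_trace)

definition stiefel :: "(real^'n^'m) set" where
  "stiefel = {X. transpose X ** X = mat 1}"

definition stiefel_tangent :: "real^'n^'m \<Rightarrow> (real^'n^'m) set" where
  "stiefel_tangent X = {Y. transpose X ** Y + transpose Y ** X = 0}"

definition gradient :: "('a::real_inner \<Rightarrow> real) \<Rightarrow> 'a \<Rightarrow> 'a" where
  "gradient f x = (THE D. GDERIV f x :> D)"

text \<open>The tangent space is a linear subspace, so the closest point is the orthogonal projection.\<close>

definition riemannian_grad :: "(real^'n^'m \<Rightarrow> real) \<Rightarrow> real^'n^'m \<Rightarrow> real^'n^'m" where
  "riemannian_grad f X = closest_point (stiefel_tangent X) (gradient f X)"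

text \<open>For continuously differentiable \<open>f\<close> this set is closed and, by compactness of the Stiefel
  manifold, non-empty when \<open>n \<le> m\<close>; then \<open>infdist\<close> to it is the minimal Frobenius distance.\<close>

definition critical_points :: "(real^'n^'m \<Rightarrow> real) \<Rightarrow> (real^'n^'m) set" where
  "critical_points f = {X \<in> stiefel. riemannian_grad f X = 0}"

definition quad_trace :: "real^'m^'m \<Rightarrow> real^'n^'n \<Rightarrow> real^'n^'m \<Rightarrow> real" where
  "quad_trace A B X = trace (transpose X ** A ** X ** B)"

definition D_rho :: "(real^'n^'m \<Rightarrow> real) \<Rightarrow> real \<Rightarrow> real^'n^'m \<Rightarrow> real^'n^'m" where
  "D_rho f \<rho> X = gradient f X
     - X ** ((2 * \<rho>) *\<^sub>R (transpose (gradient f X) ** X)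
             + (1 - 2 * \<rho>) *\<^sub>R (transpose X ** gradient f X))"

lemma transpose_add: "transpose (X + Y) = transpose X + transpose Y"
  for X Y :: "real^'n^'m"
  by (simp add: transpose_def vec_eq_iff)

lemma transpose_diff: "transpose (X - Y) = transpose X - transpose Y"
  for X Y :: "real^'n^'m"
  by (simp add: transpose_def vec_eq_iff)

lemma matrix_mul_scaleR:
  fixes X :: "real^'n^'m" and Y :: "real^'k^'n"
  shows "(c *\<^sub>R X) ** Y = c *\<^sub>R (X ** Y)" "X ** (c *\<^sub>R Y) = c *\<^sub>R (X ** Y)"
  by (simp_all add: matrix_matrix_mult_def vec_eq_iff sum_distrib_left algebra_simps)

lemma matrix_add_rdistrib: "(X + Y) ** Z = X ** Z + Y ** Z"
  for X Y :: "real^'n^'m" and Z :: "real^'k^'n"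
  by (simp add: matrix_matrix_mult_def vec_eq_iff algebra_simps sum.distrib)

lemma matrix_diff_rdistrib: "(X - Y) ** Z = X ** Z - Y ** Z"
  for X Y :: "real^'n^'m" and Z :: "real^'k^'n"
  by (simp add: matrix_matrix_mult_def vec_eq_iff algebra_simps sum_subtractf)

lemma matrix_diff_ldistrib: "Z ** (X - Y) = Z ** X - Z ** Y"
  for X Y :: "real^'n^'m" and Z :: "real^'m^'k"
  by (simp add: matrix_matrix_mult_def vec_eq_iff algebra_simps sum_subtractf)

lemma gradient_eqI:
  assumes "GDERIV f x :> D"
  shows "gradient f x = D"
  unfolding gradient_def
proof (rule the_equality)
  show "GDERIV f x :> D" by (rule assms)
next
  fix D' assume "GDERIV f x :> D'"
  then have "(\<lambda>h. inner h D') = (\<lambda>h. inner h D)"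
    using assms unfolding gderiv_def by (rule has_derivative_unique)
  then show "D' = D"
    unfolding fun_eq_iff by (rule vector_eq_ldot[THEN iffD1])
qed

lemma quad_trace_eq_inner: "quad_trace A B X = inner X (A ** X ** B)"
  by (simp add: quad_trace_def inner_eq_trace matrix_mul_assoc)

lemma gradient_quad_trace:
  fixes A :: "real^'m^'m" and B :: "real^'n^'n" and X :: "real^'n^'m"
  assumes "transpose A = A" "transpose B = B"
  shows "gradient (quad_trace A B) X = 2 *\<^sub>R (A ** X ** B)"
proof (rule gradient_eqI)
  have lin: "linear (\<lambda>X::real^'n^'m. A ** X ** B)"
    by (rule linearI) (simp_all add: matrix_add_ldistrib matrix_add_rdistrib matrix_mul_scaleR)
  have sym: "inner X (A ** H ** B) = inner H (A ** X ** B)" for H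
  proof -
    have "trace (transpose X ** (A ** H ** B)) = trace (transpose (transpose X ** (A ** H ** B)))"
      by (simp add: trace_def transpose_def)
    also have "\<dots> = trace (B ** (transpose H ** A ** X))"
      by (simp add: matrix_transpose_mul assms matrix_mul_assoc)
    also have "\<dots> = trace (transpose H ** A ** X ** B)"
      by (rule trace_mul_sym)
    finally show ?thesis
      by (simp add: inner_eq_trace matrix_mul_assoc)
  qed
  have "((\<lambda>X. inner X (A ** X ** B)) has_derivative
          (\<lambda>H. inner X (A ** H ** B) + inner H (A ** X ** B))) (at X)"
    by (rule has_derivative_inner[OF has_derivative_ident linear_imp_has_derivative[OF lin]])
  moreover have "(\<lambda>H. inner X (A ** H ** B) + inner H (A ** X ** B))
      = (\<lambda>H. inner H (2 *\<^sub>R (A ** X ** B)))"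
  proof
    fix H
    show "inner X (A ** H ** B) + inner H (A ** X ** B) = inner H (2 *\<^sub>R (A ** X ** B))"
      using sym[of H] by simp
  qed
  moreover have "quad_trace A B = (\<lambda>X. inner X (A ** X ** B))"
    by (rule ext) (rule quad_trace_eq_inner)
  ultimately show "GDERIV (quad_trace A B) X :> 2 *\<^sub>R (A ** X ** B)"
    by (simp only: gderiv_def)
qed

lemma riemannian_grad_quad_trace:
  fixes A :: "real^'m^'m" and B :: "real^'n^'n" and X :: "real^'n^'m"
  assumes A: "transpose A = A" and B: "transpose B = B" and X: "X \<in> stiefel"
  shows "riemannian_grad (quad_trace A B) X
           = 2 *\<^sub>R (A ** X ** B) - X ** transpose X ** A ** X ** B - X ** B ** transpose X ** A ** X"
    (is "_ = ?P")
proof -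
  let ?T = "stiefel_tangent X" and ?G = "2 *\<^sub>R (A ** X ** B)"
  define S where "S = transpose X ** A ** X ** B + B ** transpose X ** A ** X"
  have XX: "transpose X ** X = mat 1"
    using X by (simp add: stiefel_def)
  have XXM: "transpose X ** (X ** M) = M" for M :: "real^'n^'n"
    by (simp add: matrix_mul_assoc XX)
  have S: "transpose S = S"
    by (simp add: S_def transpose_add matrix_transpose_mul A B matrix_mul_assoc add.commute)
  have P: "?P = ?G - X ** S"
    by (simp add: S_def matrix_add_ldistrib matrix_mul_assoc)
  have XG: "transpose X ** ?G + transpose ?G ** X = 2 *\<^sub>R S"
    by (simp add: S_def matrix_mul_scaleR transpose_scalar matrix_transpose_mul A B
        matrix_mul_assoc scaleR_add_right)
  have "transpose X ** (?G - X ** S) + transpose (?G - X ** S) ** X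
      = (transpose X ** ?G + transpose ?G ** X) - (S + S ** (transpose X ** X))"
    by (simp add: matrix_diff_ldistrib matrix_diff_rdistrib transpose_diff matrix_transpose_mul S XXM
        matrix_mul_assoc[of S, symmetric])
  also have "\<dots> = 0"
    unfolding XG XX by (simp add: scaleR_2)
  finally have PT: "?P \<in> ?T"
    unfolding P stiefel_tangent_def by simp
  have "linear (\<lambda>Y. transpose X ** Y + transpose Y ** X)"
    by (rule linearI) (simp_all add: transpose_add matrix_add_ldistrib matrix_add_rdistrib
        matrix_mul_scaleR transpose_scalar scaleR_add_right)
  then have sub: "subspace ?T"
    unfolding stiefel_tangent_def by (rule linear_subspace_kernel)
  have orth: "inner (X ** S) Y = 0" if "Y \<in> ?T" for Y
  proof -
    have "trace (S ** (transpose Y ** X)) = trace (transpose (S ** (transpose Y ** X)))"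
      by (simp add: trace_def transpose_def)
    also have "\<dots> = trace (S ** (transpose X ** Y))"
      by (subst trace_mul_sym) (simp add: matrix_transpose_mul S)
    finally have "2 * trace (S ** (transpose X ** Y))
        = trace (S ** (transpose X ** Y + transpose Y ** X))"
      by (simp add: matrix_add_ldistrib trace_add)
    also have "\<dots> = 0"
      using that by (simp add: stiefel_tangent_def trace_def)
    finally show ?thesis
      by (simp add: inner_eq_trace matrix_transpose_mul S matrix_mul_assoc)
  qed
  have le: "dist ?G ?P \<le> dist ?G Z" if Z: "Z \<in> ?T" for Z
  proof -
    define V where "V = ?P - Z"
    define N where "N = X ** S"
    have "inner N V = 0"
      unfolding N_def V_def by (rule orth[OF subspace_diff[OF sub PT Z]])
    then have "norm (N + V) ^ 2 = norm N ^ 2 + norm V ^ 2"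
      by (simp add: power2_norm_eq_inner inner_add_left inner_add_right inner_commute)
    then have "norm N ^ 2 \<le> norm (N + V) ^ 2"
      by simp
    then have "norm N \<le> norm (N + V)"
      by (rule power2_le_imp_le) (rule norm_ge_zero)
    moreover have "?G - ?P = N" "?G - Z = N + V"
      unfolding V_def N_def P by simp_all
    ultimately show ?thesis
      by (simp only: dist_norm)
  qed
  show ?thesis
    unfolding riemannian_grad_def gradient_quad_trace[OF A B]
    using le by (intro closest_point_unique[symmetric] PT subspace_imp_convex[OF sub]
        closed_subspace[OF sub]) blast
qed

end

theory Submission
  imports Defs
begin

text \<open>Write \<open>C = X\<^sup>TAX\<close> and \<open>D = D\<^sub>\<rho>(X)\<close>. The component of \<open>D\<close> along \<open>X\<close> is \<open>4\<rho>(CB - BC)\<close>, and its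
  component orthogonal to \<open>X\<close> is \<open>2(AXB - XCB)\<close> (\<open>D_rho_components\<close>). So \<open>X\<close> is critical iff both
  vanish, that is, iff \<open>X\<close> maps every eigenspace of \<open>B\<close> for a nonzero eigenvalue onto an
  \<open>A\<close>-invariant subspace; on the kernel of \<open>B\<close> nothing is required. Equivalently, there is an
  orthonormal eigenbasis \<open>U\<close> of \<open>B\<close> such that \<open>Xu\<close> is an eigenvector of \<open>A\<close> for each \<open>u \<in> U\<close>
  outside the kernel.

  The error bound is a quantitative version of this description. If \<open>D\<close> is small, then \<open>C\<close> nearly
  commutes with \<open>B\<close>. Take an eigenbasis \<open>U\<close> of \<open>B\<close> that also diagonalises the block of \<open>C\<close> on each
  eigenspace of \<open>B\<close> (\<open>orthonormal_eigenbasis_adapted\<close>). The gap between the eigenvalues of \<open>B\<close>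
  bounds all other entries of \<open>C\<close> by a multiple of \<open>\<parallel>D\<parallel>\<close>, so each \<open>Xu\<close> with \<open>u\<close> outside the kernel
  is an approximate eigenvector of \<open>A\<close> (\<open>columns_are_approximate_eigenvectors\<close>). The gap between the
  eigenvalues of \<open>A\<close> then places \<open>Xu\<close> within a multiple of \<open>\<parallel>D\<parallel>\<close> of an eigenspace of \<open>A\<close>
  (\<open>approximate_eigenvector_near_eigenvector\<close>). Distinct eigenspaces of \<open>A\<close> are orthogonal, so a
  Gram--Schmidt process can restore exact orthonormality without leaving these eigenspaces and
  without moving the vectors by more than a multiple of \<open>\<parallel>D\<parallel>\<close>
  (\<open>orthonormal_family_in_subspaces\<close>). The resulting vectors are the images of \<open>U\<close> under a
  critical point.

  All constants depend only on \<open>A\<close>, \<open>B\<close>, \<open>\<rho>\<close> and the dimensions. The construction works when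
  \<open>\<kappa>\<parallel>D\<parallel> \<le> 1\<close> for some constant \<open>\<kappa>\<close>. For larger residuals the bound with \<open>\<eta> = \<kappa>\<close> is implied
  by a distance to the critical points of at most \<open>1\<close>, so \<open>\<delta> = 1\<close> will do.\<close>

section \<open>Orthonormal families\<close>

definition orthonormal_family :: "('i \<Rightarrow> 'a::real_inner) \<Rightarrow> 'i set \<Rightarrow> bool" where
  "orthonormal_family x S \<longleftrightarrow> (\<forall>i\<in>S. \<forall>j\<in>S. x i \<bullet> x j = (if i = j then 1 else 0))"

abbreviation orthonormal_set :: "'a::real_inner set \<Rightarrow> bool" where
  "orthonormal_set \<equiv> orthonormal_family (\<lambda>u. u)"

lemma orthonormal_familyD:
  assumes "orthonormal_family x S" "i \<in> S"
  shows "j \<in> S \<Longrightarrow> i \<noteq> j \<Longrightarrow> x i \<bullet> x j = 0" and "x i \<bullet> x i = 1" and "norm (x i) = 1"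
  using assms by (auto simp: orthonormal_family_def norm_eq_sqrt_inner)

lemma orthonormal_set_imp_pairwise_orthogonal:
  assumes "orthonormal_set U"
  shows "pairwise orthogonal U"
  using assms by (auto simp: orthonormal_family_def pairwise_def orthogonal_def)

lemma orthonormal_set_imp_finite:
  fixes U :: "'a::euclidean_space set"
  assumes "orthonormal_set U"
  shows "finite U"
  by (rule pairwise_orthogonal_imp_finite[OF orthonormal_set_imp_pairwise_orthogonal[OF assms]])

lemma orthonormal_set_expand:
  fixes U :: "'a::euclidean_space set"
  assumes "orthonormal_set U" "x \<in> span U"
  shows "(\<Sum>u\<in>U. (x \<bullet> u) *\<^sub>R u) = x"
  by (rule orthonormal_basis_expand[OF orthonormal_set_imp_pairwise_orthogonal[OF assms(1)]
        orthonormal_familyD(3)[OF assms(1)] assms(2) orthonormal_set_imp_finite[OF assms(1)]])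

lemma card_orthonormal_basis:
  fixes U :: "'a::euclidean_space set"
  assumes "orthonormal_set U" "span U = UNIV"
  shows "card U = DIM('a)"
proof -
  have "0 \<notin> U"
    using orthonormal_familyD(2)[OF assms(1)] by fastforce
  then have "independent U"
    by (intro pairwise_orthogonal_independent orthonormal_set_imp_pairwise_orthogonal assms)
  then have "card U = dim (span U)"
    by (rule dim_span_eq_card_independent[symmetric])
  then show ?thesis
    using assms(2) by simp
qed

lemma norm_le_sum_coords:
  fixes U :: "'a::euclidean_space set"
  assumes "orthonormal_set U" "span U = UNIV"
  shows "norm x \<le> (\<Sum>u\<in>U. \<bar>x \<bullet> u\<bar>)"
proof -
  have "norm x = norm (\<Sum>u\<in>U. (x \<bullet> u) *\<^sub>R u)"
    using orthonormal_set_expand[OF assms(1)] assms(2) by simp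
  also have "\<dots> \<le> (\<Sum>u\<in>U. norm ((x \<bullet> u) *\<^sub>R u))"
    by (rule norm_sum)
  also have "\<dots> = (\<Sum>u\<in>U. \<bar>x \<bullet> u\<bar>)"
    by (intro sum.cong refl) (simp add: orthonormal_familyD(3)[OF assms(1)])
  finally show ?thesis .
qed

section \<open>Diagonalising two self-adjoint maps\<close>

text \<open>A maximiser of \<open>x \<bullet> f x\<close> on the unit sphere of \<open>S\<close> is a critical point of this
  quadratic form on the sphere.\<close>

lemma quadratic_form_critical_unit_vector:
  fixes f :: "'a::euclidean_space \<Rightarrow> 'a"
  assumes f: "linear f" and adj: "\<And>x y. f x \<bullet> y = x \<bullet> f y"
    and S: "subspace S" and ne: "x0 \<in> S" "x0 \<noteq> 0"
  obtains u where "u \<in> S" "norm u = 1" "\<And>v. v \<in> S \<Longrightarrow> u \<bullet> v = 0 \<Longrightarrow> v \<bullet> f u = 0"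
proof -
  let ?K = "S \<inter> sphere 0 1"
  have "compact ?K"
    by (intro closed_Int_compact closed_subspace[OF S] compact_sphere)
  moreover have "(1 / norm x0) *\<^sub>R x0 \<in> ?K"
    using ne subspace_scale[OF S] by simp
  then have "?K \<noteq> {}"
    by blast
  moreover have "continuous_on ?K (\<lambda>x. x \<bullet> f x)"
    by (intro continuous_intros linear_continuous_on linear_conv_bounded_linear[THEN iffD1] f)
  ultimately obtain u where u: "u \<in> ?K" and max: "\<And>y. y \<in> ?K \<Longrightarrow> y \<bullet> f y \<le> u \<bullet> f u"
    using continuous_attains_sup by metis
  have uS: "u \<in> S" and un: "norm u = 1"
    using u by auto
  have uu: "u \<bullet> u = 1"
    using un by (simp add: norm_eq_1)
  have le: "w \<bullet> f w \<le> (u \<bullet> f u) * (w \<bullet> w)" if w: "w \<in> S" for w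
  proof (cases "w = 0")
    case False
    let ?w = "(1 / norm w) *\<^sub>R w"
    have "?w \<in> ?K"
      using False w subspace_scale[OF S] by simp
    then have "?w \<bullet> f ?w \<le> u \<bullet> f u"
      by (rule max)
    then have "(w \<bullet> f w) / (norm w)\<^sup>2 \<le> u \<bullet> f u"
      by (simp add: linear_cmul[OF f] power2_eq_square)
    then show ?thesis
      using False by (simp add: divide_simps power2_norm_eq_inner)
  qed (simp add: linear_0[OF f])
  have "v \<bullet> f u = 0" if v: "v \<in> S" and uv: "u \<bullet> v = 0" for v
  proof -
    define p c where "p = v \<bullet> f u" and "c = v \<bullet> f v - (u \<bullet> f u) * (v \<bullet> v)"
    have vu: "v \<bullet> u = 0" and uv': "u \<bullet> f v = p"
      using uv adj[of u v] by (simp_all add: p_def inner_commute)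
    have t: "2 * t * p + t\<^sup>2 * c \<le> 0" for t
    proof -
      have "u + t *\<^sub>R v \<in> S"
        using uS v by (intro subspace_add[OF S] subspace_scale[OF S])
      from le[OF this] show ?thesis
        by (simp add: linear_add[OF f] linear_cmul[OF f] uu uv vu uv'
            c_def p_def[symmetric] algebra_simps power2_eq_square)
    qed
    \<comment> \<open>For small \<open>t\<close> the linear term dominates; this \<open>t\<close> is small enough.\<close>
    have "p = 0"
    proof (rule ccontr)
      assume p: "p \<noteq> 0"
      define d where "d = \<bar>c\<bar> + 1"
      have d: "d > 0" "c \<ge> - d"
        by (auto simp: d_def)
      have "2 * (p / d) * p + (p / d)\<^sup>2 * c = p\<^sup>2 / d * (2 + c / d)"
        using d by (simp add: field_simps power2_eq_square)
      moreover have "2 + c / d \<ge> 1"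
        using d by (simp add: field_simps)
      then have "p\<^sup>2 / d * (2 + c / d) > 0"
        using p d by (intro mult_pos_pos) auto
      ultimately show False
        using t[of "p / d"] by simp
    qed
    then show ?thesis
      by (simp add: p_def)
  qed
  with uS un show ?thesis
    by (rule that)
qed

text \<open>The maps \<open>f\<close> and \<open>g\<close> need not commute, so only the restriction of the form of \<open>g\<close> to each
  eigenspace of \<open>f\<close> can be diagonalised along with \<open>f\<close>. Splitting off one vector at a time, chosen
  critical for \<open>g\<close> on an eigenspace of \<open>f\<close>, achieves this. The case \<open>g = 0\<close> is the
  spectral theorem.\<close>

lemma orthonormal_eigenbasis_adapted:
  fixes f g :: "'a::euclidean_space \<Rightarrow> 'a"
  assumes f: "linear f" and fadj: "\<And>x y. f x \<bullet> y = x \<bullet> f y"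
    and g: "linear g" and gadj: "\<And>x y. g x \<bullet> y = x \<bullet> g y"
    and S: "subspace S" and inv: "f ` S \<subseteq> S"
  obtains U \<beta> where "orthonormal_set U" "span U = S" "\<And>u. u \<in> U \<Longrightarrow> f u = \<beta> u *\<^sub>R u"
    "\<And>u v. u \<in> U \<Longrightarrow> v \<in> U \<Longrightarrow> u \<noteq> v \<Longrightarrow> \<beta> u = \<beta> v \<Longrightarrow> v \<bullet> g u = 0"
proof -
  have "\<exists>U. orthonormal_set U \<and> span U = S \<and> (\<forall>u\<in>U. f u = (u \<bullet> f u) *\<^sub>R u) \<and>
    (\<forall>u\<in>U. \<forall>v\<in>U. u \<noteq> v \<longrightarrow> u \<bullet> f u = v \<bullet> f v \<longrightarrow> v \<bullet> g u = 0)"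
    using S inv
  proof (induction "dim S" arbitrary: S rule: less_induct)
    case less
    note S = less.prems(1)
    show ?case
    proof (cases "S = {0}")
      case True
      then show ?thesis
        by (intro exI[of _ "{}"]) (auto simp: orthonormal_family_def)
    next
      case False
      then obtain x0 where "x0 \<in> S" "x0 \<noteq> 0"
        using subspace_0[OF S] by blast
      then obtain e where e: "e \<in> S" "norm e = 1" "\<And>v. v \<in> S \<Longrightarrow> e \<bullet> v = 0 \<Longrightarrow> v \<bullet> f e = 0"
        using quadratic_form_critical_unit_vector[OF f fadj S] by metis
      define b where "b = e \<bullet> f e"
      have ee: "e \<bullet> e = 1"
        using e by (simp add: norm_eq_1)
      have fe: "f e = b *\<^sub>R e"
      proof -
        let ?d = "f e - b *\<^sub>R e"
        have "?d \<in> S"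
          using e less.prems(2) by (auto intro: subspace_diff[OF S] subspace_scale[OF S])
        moreover have "e \<bullet> ?d = 0"
          by (simp add: inner_diff_right b_def ee)
        ultimately have "?d \<bullet> f e = 0" "?d \<bullet> e = 0"
          by (rule e(3), simp only: inner_commute)
        then have "?d \<bullet> ?d = 0"
          unfolding inner_diff_right[of ?d "f e"] by simp
        then show ?thesis
          by simp
      qed
      define W where "W = {x \<in> S. f x = b *\<^sub>R x}"
      have W: "subspace W"
        unfolding subspace_def W_def
        using S by (auto simp: linear_0[OF f] linear_add[OF f] linear_cmul[OF f] subspace_0
            subspace_add subspace_scale scaleR_add_right)
      have "e \<in> W" "e \<noteq> 0"
        using e fe by (auto simp: W_def)
      then obtain u where u: "u \<in> W" "norm u = 1" "\<And>v. v \<in> W \<Longrightarrow> u \<bullet> v = 0 \<Longrightarrow> v \<bullet> g u = 0"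
        using quadratic_form_critical_unit_vector[OF g gadj W] by metis
      have uS: "u \<in> S" and fu: "f u = b *\<^sub>R u" and uu: "u \<bullet> u = 1"
        using u by (auto simp: W_def norm_eq_1)
      define S' where "S' = {x \<in> S. u \<bullet> x = 0}"
      have S': "subspace S'"
        unfolding subspace_def S'_def
        using S by (auto simp: subspace_0 subspace_add subspace_scale inner_add_right)
      have "f x \<in> S'" if "x \<in> S'" for x
        using that less.prems(2) fadj[of u x] by (auto simp: S'_def fu)
      then have inv': "f ` S' \<subseteq> S'"
        by blast
      have "u \<notin> S'"
        using uu by (simp add: S'_def)
      moreover have "S' \<subseteq> S"
        by (auto simp: S'_def)
      ultimately have "S' \<subset> S"
        using uS by blast
      then have "dim S' < dim S"
        using S S' by (intro dim_psubset) (simp add: span_eq_iff[THEN iffD2])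
      from less.hyps[OF this S' inv'] obtain U where U: "orthonormal_set U" "span U = S'"
        "\<forall>u\<in>U. f u = (u \<bullet> f u) *\<^sub>R u"
        "\<forall>u\<in>U. \<forall>v\<in>U. u \<noteq> v \<longrightarrow> u \<bullet> f u = v \<bullet> f v \<longrightarrow> v \<bullet> g u = 0"
        by blast
      have US: "U \<subseteq> S'"
        using U(2) span_superset by blast
      have perp: "u \<bullet> v = 0" "v \<bullet> u = 0" if "v \<in> U" for v
        using US that by (auto simp: S'_def inner_commute)
      have bu: "u \<bullet> f u = b"
        by (simp add: fu uu)
      have gu: "v \<bullet> g u = 0" "u \<bullet> g v = 0" if v: "v \<in> U" "v \<bullet> f v = b" for v
      proof -
        have "v \<in> W"
          using U(3) v US by (auto simp: W_def S'_def)
        then show "v \<bullet> g u = 0"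
          by (rule u(3)) (rule perp(1)[OF v(1)])
        then show "u \<bullet> g v = 0"
          using gadj[of u v] by (simp add: inner_commute)
      qed
      have "span (insert u U) = S"
      proof
        show "span (insert u U) \<subseteq> S"
          using US uS S by (intro span_minimal) (auto simp: S'_def)
        show "S \<subseteq> span (insert u U)"
        proof
          fix x assume "x \<in> S"
          then have "x - (u \<bullet> x) *\<^sub>R u \<in> S'"
            using uS by (auto simp: S'_def inner_diff_right uu intro: subspace_diff[OF S]
                subspace_scale[OF S])
          then show "x \<in> span (insert u U)"
            unfolding span_insert U(2) by blast
        qed
      qed
      moreover have "orthonormal_set (insert u U)"
        using U(1) perp uu \<open>u \<notin> S'\<close> US by (auto simp: orthonormal_family_def)
      ultimately show ?thesis
        using U(3,4) fu bu gu by (intro exI[of _ "insert u U"]) auto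
    qed
  qed
  then show ?thesis
    using that[where \<beta> = "\<lambda>u. u \<bullet> f u"] by blast
qed

lemma orthonormal_eigenbasis:
  fixes f :: "'a::euclidean_space \<Rightarrow> 'a"
  assumes "linear f" "\<And>x y. f x \<bullet> y = x \<bullet> f y"
  obtains U \<beta> where "orthonormal_set U" "span U = UNIV" "\<And>u. u \<in> U \<Longrightarrow> f u = \<beta> u *\<^sub>R u"
  using orthonormal_eigenbasis_adapted[of f "\<lambda>_. 0" UNIV] assms
  by (metis inner_zero_left inner_zero_right linear_zero subset_UNIV subspace_UNIV)

lemma finite_eigenvalues:
  fixes f :: "'a::euclidean_space \<Rightarrow> 'a"
  assumes f: "linear f" and adj: "\<And>x y. f x \<bullet> y = x \<bullet> f y"
  shows "finite {a. \<exists>v. v \<noteq> 0 \<and> f v = a *\<^sub>R v}"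
proof -
  obtain U \<beta> where U: "orthonormal_set U" "span U = UNIV" "\<And>u. u \<in> U \<Longrightarrow> f u = \<beta> u *\<^sub>R u"
    using orthonormal_eigenbasis[OF assms] by metis
  have "a \<in> \<beta> ` U" if "v \<noteq> 0" "f v = a *\<^sub>R v" for a v
  proof -
    have "\<not> (\<forall>u\<in>U. v \<bullet> u = 0)"
    proof
      assume "\<forall>u\<in>U. v \<bullet> u = 0"
      then have "(\<Sum>u\<in>U. \<bar>v \<bullet> u\<bar>) = 0"
        by simp
      then show False
        using norm_le_sum_coords[OF U(1,2), of v] that(1) by simp
    qed
    then obtain u where u: "u \<in> U" "v \<bullet> u \<noteq> 0"
      by blast
    then have "a * (v \<bullet> u) = \<beta> u * (v \<bullet> u)"
      using adj[of v u] that(2) U(3) by simp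
    then show ?thesis
      using u by auto
  qed
  then have "{a. \<exists>v. v \<noteq> 0 \<and> f v = a *\<^sub>R v} \<subseteq> \<beta> ` U"
    by blast
  then show ?thesis
    by (rule finite_subset) (simp add: orthonormal_set_imp_finite[OF U(1)])
qed

lemma finite_real_set_gap:
  fixes S :: "real set"
  assumes "finite S"
  obtains g where "g > 0" "\<And>a b. a \<in> S \<Longrightarrow> b \<in> S \<Longrightarrow> a \<noteq> b \<Longrightarrow> g \<le> \<bar>a - b\<bar>"
proof -
  let ?D = "insert 1 ((\<lambda>(a, b). \<bar>a - b\<bar>) ` {(a, b) \<in> S \<times> S. a \<noteq> b})"
  have "finite {(a, b) \<in> S \<times> S. a \<noteq> b}"
    by (rule finite_subset[OF _ finite_cartesian_product[OF assms assms]]) auto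
  then have fin: "finite ?D"
    by blast
  show ?thesis
  proof
    have "Min ?D \<in> ?D"
      using fin by (intro Min_in) auto
    then show "0 < Min ?D"
      by auto
    fix a b assume "a \<in> S" "b \<in> S" "a \<noteq> b"
    then show "Min ?D \<le> \<bar>a - b\<bar>"
      using fin by (intro Min_le) force+
  qed
qed

section \<open>Approximate eigenvectors\<close>

text \<open>Rounding \<open>l\<close> to the nearest eigenvalue \<open>a\<close> keeps \<open>l\<close> at distance at least half the spectral
  gap from all the others, so the components of \<open>x\<close> outside the eigenspace of \<open>a\<close> are
  controlled by the residual.\<close>

lemma approximate_eigenvector_near_eigenvector:
  fixes f :: "'a::euclidean_space \<Rightarrow> 'a"
  assumes f: "linear f" and adj: "\<And>x y. f x \<bullet> y = x \<bullet> f y"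
  obtains K where "K > 0"
    "\<And>x l. \<exists>a y. f y = a *\<^sub>R y \<and> norm (x - y) \<le> K * norm (f x - l *\<^sub>R x)"
proof -
  obtain U \<beta> where U: "orthonormal_set U" "span U = UNIV" "\<And>u. u \<in> U \<Longrightarrow> f u = \<beta> u *\<^sub>R u"
    using orthonormal_eigenbasis[OF assms] by metis
  have fin: "finite U"
    by (rule orthonormal_set_imp_finite[OF U(1)])
  have "card U = DIM('a)"
    by (rule card_orthonormal_basis[OF U(1,2)])
  then have card: "card U > 0"
    by simp
  then have ne: "U \<noteq> {}"
    by auto
  obtain g where g: "g > 0" "\<And>a b. a \<in> \<beta> ` U \<Longrightarrow> b \<in> \<beta> ` U \<Longrightarrow> a \<noteq> b \<Longrightarrow> g \<le> \<bar>a - b\<bar>"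
    using finite_real_set_gap[of "\<beta> ` U"] fin by blast
  have "\<exists>a y. f y = a *\<^sub>R y \<and> norm (x - y) \<le> (real (card U) * (2 / g)) * norm (f x - l *\<^sub>R x)"
    for x l
  proof -
    define \<epsilon> where "\<epsilon> = norm (f x - l *\<^sub>R x)"
    obtain e where e: "e \<in> U" "\<And>u. u \<in> U \<Longrightarrow> \<bar>\<beta> e - l\<bar> \<le> \<bar>\<beta> u - l\<bar>"
      using ex_is_arg_min_if_finite[OF fin ne, of "\<lambda>u. \<bar>\<beta> u - l\<bar>"]
      by (auto simp: is_arg_min_linorder)
    define y where "y = (\<Sum>u \<in> {u \<in> U. \<beta> u = \<beta> e}. (x \<bullet> u) *\<^sub>R u)"
    have "f y = \<beta> e *\<^sub>R y"
      unfolding y_def linear_sum[OF f] scaleR_sum_right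
      by (intro sum.cong refl) (simp add: linear_cmul[OF f] U(3))
    moreover have "norm (x - y) \<le> (real (card U) * (2 / g)) * \<epsilon>"
    proof -
      have "x - y = (\<Sum>u\<in>U. (x \<bullet> u) *\<^sub>R u) - y"
        using orthonormal_set_expand[OF U(1)] U(2) by simp
      also have "\<dots> = (\<Sum>u \<in> {u \<in> U. \<beta> u \<noteq> \<beta> e}. (x \<bullet> u) *\<^sub>R u)"
      proof -
        have "U = {u \<in> U. \<beta> u = \<beta> e} \<union> {u \<in> U. \<beta> u \<noteq> \<beta> e}"
          by blast
        then have "(\<Sum>u\<in>U. (x \<bullet> u) *\<^sub>R u) = y + (\<Sum>u \<in> {u \<in> U. \<beta> u \<noteq> \<beta> e}. (x \<bullet> u) *\<^sub>R u)"
          unfolding y_def using fin by (subst sum.union_disjoint[symmetric]) auto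
        then show ?thesis
          by simp
      qed
      finally have "norm (x - y) = norm (\<Sum>u \<in> {u \<in> U. \<beta> u \<noteq> \<beta> e}. (x \<bullet> u) *\<^sub>R u)"
        by (rule arg_cong)
      also have "\<dots> \<le> (\<Sum>u \<in> {u \<in> U. \<beta> u \<noteq> \<beta> e}. norm ((x \<bullet> u) *\<^sub>R u))"
        by (rule norm_sum)
      also have "\<dots> \<le> (\<Sum>u \<in> {u \<in> U. \<beta> u \<noteq> \<beta> e}. 2 / g * \<epsilon>)"
      proof (rule sum_mono)
        fix u assume "u \<in> {u \<in> U. \<beta> u \<noteq> \<beta> e}"
        then have u: "u \<in> U" "\<beta> u \<noteq> \<beta> e"
          by auto
        have "g \<le> \<bar>\<beta> u - \<beta> e\<bar>"
          using g(2) u e(1) by blast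
        also have "\<dots> \<le> 2 * \<bar>\<beta> u - l\<bar>"
          using e(2)[OF u(1)] abs_triangle_ineq4[of "\<beta> u - l" "\<beta> e - l"] by simp
        finally have half: "g / 2 \<le> \<bar>\<beta> u - l\<bar>"
          by simp
        have "(\<beta> u - l) * (x \<bullet> u) = (f x - l *\<^sub>R x) \<bullet> u"
          by (simp add: adj U(3)[OF u(1)] algebra_simps)
        then have "\<bar>\<beta> u - l\<bar> * \<bar>x \<bullet> u\<bar> \<le> \<epsilon>"
          using Cauchy_Schwarz_ineq2[of "f x - l *\<^sub>R x" u] orthonormal_familyD(3)[OF U(1) u(1)]
          by (simp add: \<epsilon>_def flip: abs_mult)
        moreover have "g / 2 * \<bar>x \<bullet> u\<bar> \<le> \<bar>\<beta> u - l\<bar> * \<bar>x \<bullet> u\<bar>"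
          by (rule mult_right_mono[OF half]) simp
        ultimately have "g / 2 * \<bar>x \<bullet> u\<bar> \<le> \<epsilon>"
          by linarith
        then show "norm ((x \<bullet> u) *\<^sub>R u) \<le> 2 / g * \<epsilon>"
          using g(1) orthonormal_familyD(3)[OF U(1) u(1)] by (simp add: field_simps)
      qed
      also have "\<dots> = real (card {u \<in> U. \<beta> u \<noteq> \<beta> e}) * (2 / g * \<epsilon>)"
        by simp
      also have "\<dots> \<le> real (card U) * (2 / g * \<epsilon>)"
        using fin g(1) by (intro mult_right_mono) (auto intro: card_mono simp: \<epsilon>_def)
      finally show ?thesis
        by (simp add: mult.assoc)
    qed
    ultimately show ?thesis
      unfolding \<epsilon>_def by blast
  qed
  moreover have "real (card U) * (2 / g) > 0"
    using card g(1) by simp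
  ultimately show ?thesis
    using that by blast
qed

section \<open>Orthonormalisation inside prescribed subspaces\<close>

text \<open>Growth of the distance from the given vectors over \<open>k\<close> steps of the process: a new vector
  inherits the errors of all its predecessors, and normalising it doubles its own.\<close>

primrec gram_schmidt_const :: "nat \<Rightarrow> real" where
  "gram_schmidt_const 0 = 1"
| "gram_schmidt_const (Suc k) = 2 * (1 + real (Suc k) * (1 + gram_schmidt_const k))"

lemma gram_schmidt_const_pos: "gram_schmidt_const k > 0"
proof (induction k)
  case (Suc k)
  then have "0 \<le> real (Suc k) * (1 + gram_schmidt_const k)"
    by (intro mult_nonneg_nonneg) auto
  then show ?case
    by (simp del: of_nat_Suc)
qed simp

text \<open>Gram--Schmidt applied to points \<open>y i\<close> of \<open>V i\<close> close to the \<open>x i\<close>. The vectors \<open>z j\<close>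
  already constructed are subtracted from \<open>y i\<close> only if \<open>V j \<subseteq> V i\<close>; otherwise
  they are orthogonal to \<open>y i\<close>. Hence \<open>z i\<close> stays in \<open>V i\<close>, provided that the vectors are
  processed in the order of the ranks \<open>r\<close>.\<close>

lemma orthonormal_family_in_subspaces:
  fixes x :: "'i \<Rightarrow> 'a::real_inner" and r :: "'i \<Rightarrow> nat"
  assumes "finite S" "orthonormal_family x S"
    and "\<And>i. i \<in> S \<Longrightarrow> subspace (V i)"
    and "\<And>i j. i \<in> S \<Longrightarrow> j \<in> S \<Longrightarrow> r j \<le> r i \<Longrightarrow>
      V j \<subseteq> V i \<or> (\<forall>a\<in>V j. \<forall>b\<in>V i. a \<bullet> b = 0)"
    and "\<And>i. i \<in> S \<Longrightarrow> y i \<in> V i \<and> norm (x i - y i) \<le> \<epsilon>"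
    and "0 \<le> \<epsilon>" and "gram_schmidt_const (card S) * \<epsilon> \<le> 1"
  obtains z where "orthonormal_family z S"
    "\<And>i. i \<in> S \<Longrightarrow> z i \<in> V i \<and> norm (x i - z i) \<le> gram_schmidt_const (card S) * \<epsilon>"
proof -
  have "\<exists>z. orthonormal_family z S \<and>
    (\<forall>i\<in>S. z i \<in> V i \<and> norm (x i - z i) \<le> gram_schmidt_const (card S) * \<epsilon>)"
    using assms
  proof (induction S rule: finite_ranking_induct[where f = r])
    case empty
    then show ?case
      by (simp add: orthonormal_family_def)
  next
    case (insert k T)
    show ?case
    proof (cases "k \<in> T")
      case True
      then show ?thesis
        using insert by (simp add: insert_absorb)
    next
      case False
      let ?c = "gram_schmidt_const (card T)" and ?C = "gram_schmidt_const (card (insert k T))"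
      note eps = \<open>0 \<le> \<epsilon>\<close>
      have C: "?C = 2 * (1 + real (Suc (card T)) * (1 + ?c))"
        using False insert.hyps(1) by simp
      define q where "q = real (Suc (card T)) * (1 + ?c)"
      have "1 * (1 + ?c) \<le> q"
        unfolding q_def using gram_schmidt_const_pos[of "card T"] by (intro mult_right_mono) auto
      then have cC: "?c \<le> ?C"
        using C gram_schmidt_const_pos[of "card T"] unfolding q_def[symmetric] by simp
      have "?c * \<epsilon> \<le> ?C * \<epsilon>"
        by (rule mult_right_mono[OF cC eps])
      then have "?c * \<epsilon> \<le> 1"
        using insert.prems(6) by linarith
      moreover have xT: "orthonormal_family x T"
        using insert.prems(1) by (simp add: orthonormal_family_def)
      ultimately have "\<exists>z. orthonormal_family z T \<and>
          (\<forall>i\<in>T. z i \<in> V i \<and> norm (x i - z i) \<le> ?c * \<epsilon>)"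
        by (intro insert.IH insert.prems(2-5)) auto
      then obtain z where z: "orthonormal_family z T"
        "\<And>i. i \<in> T \<Longrightarrow> z i \<in> V i" "\<And>i. i \<in> T \<Longrightarrow> norm (x i - z i) \<le> ?c * \<epsilon>"
        by blast
      have yk: "y k \<in> V k" "norm (x k - y k) \<le> \<epsilon>"
        using insert.prems(4) by auto
      have Vk: "subspace (V k)"
        using insert.prems(2) by simp
      have xk: "norm (x k) = 1"
        using orthonormal_familyD(3)[OF insert.prems(1)] by simp
      define w where "w = y k - (\<Sum>j\<in>T. (y k \<bullet> z j) *\<^sub>R z j)"
      have "(y k \<bullet> z j) *\<^sub>R z j \<in> V k" if "j \<in> T" for j
      proof -
        have "V j \<subseteq> V k \<or> (\<forall>a\<in>V j. \<forall>b\<in>V k. a \<bullet> b = 0)"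
          using insert.prems(3)[of k j] insert.hyps(2)[OF that] that by blast
        then show ?thesis
        proof
          assume "V j \<subseteq> V k"
          then show ?thesis
            using z(2)[OF that] Vk subspace_scale by blast
        next
          assume "\<forall>a\<in>V j. \<forall>b\<in>V k. a \<bullet> b = 0"
          then have "y k \<bullet> z j = 0"
            using z(2)[OF that] yk(1) by (metis inner_commute)
          then show ?thesis
            using subspace_0[OF Vk] by simp
        qed
      qed
      then have wV: "w \<in> V k"
        unfolding w_def using yk(1) by (intro subspace_diff[OF Vk] subspace_sum[OF Vk]) auto
      have wz: "w \<bullet> z i = 0" if i: "i \<in> T" for i
      proof -
        have "(\<Sum>j\<in>T. (y k \<bullet> z j) *\<^sub>R z j) \<bullet> z i = (\<Sum>j\<in>T. if j = i then y k \<bullet> z i else 0)"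
          unfolding inner_sum_left
          using z(1) i by (intro sum.cong refl) (auto simp: orthonormal_family_def)
        also have "\<dots> = y k \<bullet> z i"
          using insert.hyps(1) i by simp
        finally show ?thesis
          by (simp add: w_def inner_diff_left)
      qed
      have yz: "\<bar>y k \<bullet> z j\<bar> \<le> (1 + ?c) * \<epsilon>" if j: "j \<in> T" for j
      proof -
        have "x k \<bullet> x j = 0"
          using orthonormal_familyD(1)[OF insert.prems(1), of k j] j False by auto
        then have "y k \<bullet> z j = - ((x k - y k) \<bullet> z j) - x k \<bullet> (x j - z j)"
          by (simp add: inner_diff_left inner_diff_right)
        also have "\<bar>\<dots>\<bar> \<le> \<bar>(x k - y k) \<bullet> z j\<bar> + \<bar>x k \<bullet> (x j - z j)\<bar>"
          by linarith
        also have "\<dots> \<le> norm (x k - y k) * norm (z j) + norm (x k) * norm (x j - z j)"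
          by (intro add_mono Cauchy_Schwarz_ineq2)
        also have "\<dots> \<le> \<epsilon> + ?c * \<epsilon>"
          using yk(2) z(3)[OF j] orthonormal_familyD(3)[OF z(1) j] xk by simp
        finally show ?thesis
          by (simp add: algebra_simps)
      qed
      have "norm (x k - w) \<le> norm (x k - y k) + norm (\<Sum>j\<in>T. (y k \<bullet> z j) *\<^sub>R z j)"
        unfolding w_def using norm_triangle_ineq[of "x k - y k"] by (metis diff_diff_eq2 diff_add_eq)
      also have "\<dots> \<le> \<epsilon> + (\<Sum>j\<in>T. (1 + ?c) * \<epsilon>)"
        using yk(2) yz orthonormal_familyD(3)[OF z(1)] by (intro add_mono sum_norm_le) auto
      also have "\<dots> = (1 + real (card T) * (1 + ?c)) * \<epsilon>"
        by (simp add: algebra_simps)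
      also have "\<dots> \<le> (1 + real (Suc (card T)) * (1 + ?c)) * \<epsilon>"
        using gram_schmidt_const_pos[of "card T"] eps by (intro mult_right_mono add_mono) auto
      also have "\<dots> = ?C * \<epsilon> / 2"
        by (simp add: C)
      finally have xw: "norm (x k - w) \<le> ?C * \<epsilon> / 2" .
      then have "norm (x k - w) \<le> 1 / 2"
        using insert.prems(6) by linarith
      then have w0: "w \<noteq> 0"
        using xk by auto
      define zk where "zk = (1 / norm w) *\<^sub>R w"
      have "w - zk = (1 - 1 / norm w) *\<^sub>R w"
        by (simp add: zk_def scaleR_diff_left)
      then have "norm (w - zk) = \<bar>(1 - 1 / norm w) * norm w\<bar>"
        by (simp add: abs_mult)
      also have "\<dots> = \<bar>norm w - norm (x k)\<bar>"
        using w0 xk by (simp add: algebra_simps)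
      also have "\<dots> \<le> norm (x k - w)"
        by (metis norm_minus_commute norm_triangle_ineq3)
      finally have "norm (x k - zk) \<le> ?C * \<epsilon>"
        using xw norm_triangle_ineq[of "x k - w" "w - zk"] by simp
      moreover have "zk \<in> V k"
        unfolding zk_def by (rule subspace_scale[OF Vk wV])
      moreover have "zk \<bullet> zk = 1"
        using w0 by (simp add: zk_def power2_norm_eq_inner[symmetric] power2_eq_square)
      moreover have "zk \<bullet> z i = 0" "z i \<bullet> zk = 0" if "i \<in> T" for i
        using wz[OF that] by (simp_all add: zk_def inner_commute)
      moreover have "norm (x i - z i) \<le> ?C * \<epsilon>" if "i \<in> T" for i
        using z(3)[OF that] \<open>?c * \<epsilon> \<le> ?C * \<epsilon>\<close> by linarith
      ultimately show ?thesis
        using z(1,2) False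
        by (intro exI[of _ "z(k := zk)"]) (auto simp: orthonormal_family_def)
    qed
  qed
  then show ?thesis
    using that by blast
qed

section \<open>Matrices acting on orthonormal bases\<close>

text \<open>Adjoints stay visible as transposes, ready to be moved across inner products.\<close>

declare transpose_matrix_vector [simp del]

lemma inner_matrix_vector_mult_left:
  fixes M :: "real^'n^'m"
  shows "(M *v x) \<bullet> y = x \<bullet> (transpose M *v y)"
  by (simp add: dot_lmul_matrix[symmetric] inner_commute transpose_matrix_vector)

lemma norm_matrix_vector_mult_le:
  fixes M :: "real^'n^'m"
  shows "norm (M *v x) \<le> norm M * norm x"
proof -
  have "norm (M *v x) \<le> L2_set (\<lambda>i. norm (M $ i) * norm x) UNIV"
    unfolding norm_vec_def[of "M *v x"]
    by (intro L2_set_mono) (auto simp: matrix_vector_mul_component Cauchy_Schwarz_ineq2)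
  also have "\<dots> = norm M * norm x"
    by (simp add: norm_vec_def[of M] L2_set_left_distrib)
  finally show ?thesis .
qed

lemma matrix_eq_on_spanning_set:
  fixes M N :: "real^'n^'m"
  assumes "span U = UNIV" "\<And>u. u \<in> U \<Longrightarrow> M *v u = N *v u"
  shows "M = N"
  unfolding matrix_eq
  using linear_eq_on_span[OF matrix_vector_mul_linear matrix_vector_mul_linear, of U M N] assms
  by auto

lemma norm_matrix_le_sum_on_basis:
  fixes M :: "real^'n^'m"
  assumes U: "orthonormal_set U" "span U = UNIV"
  shows "norm M \<le> real (CARD('m) * CARD('n)) * (\<Sum>u\<in>U. norm (M *v u))"
proof -
  have *: "\<bar>M $ i $ j\<bar> \<le> (\<Sum>u\<in>U. norm (M *v u))" for i j
  proof -
    let ?e = "axis j 1 :: real^'n"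
    have "M $ i $ j = (M *v ?e) $ i"
      by (simp add: matrix_vector_mult_basis column_def)
    also have "\<bar>\<dots>\<bar> \<le> norm (M *v ?e)"
      by (rule component_le_norm_cart)
    also have "M *v ?e = M *v (\<Sum>u\<in>U. (?e \<bullet> u) *\<^sub>R u)"
      using orthonormal_set_expand[OF U(1)] U(2) by simp
    also have "\<dots> = (\<Sum>u\<in>U. (?e \<bullet> u) *\<^sub>R (M *v u))"
      by (simp add: linear_sum[OF matrix_vector_mul_linear] linear_cmul[OF matrix_vector_mul_linear])
    also have "norm \<dots> \<le> (\<Sum>u\<in>U. norm (M *v u))"
    proof (rule sum_norm_le)
      fix u assume "u \<in> U"
      then have "\<bar>?e \<bullet> u\<bar> \<le> 1"
        using Cauchy_Schwarz_ineq2[of ?e u] orthonormal_familyD(3)[OF U(1)] by simp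
      then show "norm ((?e \<bullet> u) *\<^sub>R (M *v u)) \<le> norm (M *v u)"
        by (simp add: mult_left_le_one_le)
    qed
    finally show ?thesis .
  qed
  have "norm M \<le> (\<Sum>i\<in>UNIV. norm (M $ i))"
    by (simp add: norm_vec_def[of M] L2_set_le_sum)
  also have "\<dots> \<le> (\<Sum>i::'m\<in>UNIV. \<Sum>j::'n\<in>UNIV. \<Sum>u\<in>U. norm (M *v u))"
    by (intro sum_mono order_trans[OF norm_le_l1_cart] *)
  finally show ?thesis
    by simp
qed

lemma stiefel_transpose_mult:
  assumes "X \<in> stiefel"
  shows "transpose X *v (X *v a) = a"
  using assms by (simp add: stiefel_def matrix_vector_mul_assoc)

lemma stiefel_inner:
  assumes "X \<in> stiefel"
  shows "(X *v a) \<bullet> (X *v b) = a \<bullet> b"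
  by (simp add: inner_matrix_vector_mult_left stiefel_transpose_mult[OF assms])

lemma stiefel_norm:
  assumes "X \<in> stiefel"
  shows "norm (X *v a) = norm a"
  by (simp add: norm_eq_sqrt_inner stiefel_inner[OF assms])

lemma stiefel_norm_transpose_le:
  assumes "X \<in> stiefel"
  shows "norm (transpose X *v y) \<le> norm y"
proof (cases "transpose X *v y = 0")
  case False
  let ?t = "transpose X *v y"
  have "norm ?t * norm ?t = (X *v ?t) \<bullet> y"
    by (simp add: inner_matrix_vector_mult_left flip: power2_eq_square power2_norm_eq_inner)
  also have "\<dots> \<le> norm ?t * norm y"
    using norm_cauchy_schwarz[of "X *v ?t" y] by (simp add: stiefel_norm[OF assms])
  finally show ?thesis
    using False by simp
qed simp

lemma stiefel_orthonormal_family: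
  assumes "X \<in> stiefel" "orthonormal_set U"
  shows "orthonormal_family (\<lambda>u. X *v u) U"
  using assms(2) by (simp add: orthonormal_family_def stiefel_inner[OF assms(1)])

lemma stiefel_matrix_mapping_basis:
  fixes z :: "real^'n \<Rightarrow> real^'m"
  assumes U: "orthonormal_set U" "span U = UNIV" and z: "orthonormal_family z U"
  obtains Z where "Z \<in> stiefel" "\<And>u. u \<in> U \<Longrightarrow> Z *v u = z u"
proof -
  have fin: "finite U"
    by (rule orthonormal_set_imp_finite[OF U(1)])
  define f where "f v = (\<Sum>u\<in>U. (v \<bullet> u) *\<^sub>R z u)" for v
  have "linear f"
    unfolding f_def
    by (rule linearI) (simp_all add: inner_add_left scaleR_add_left sum.distrib scaleR_sum_right)
  then have Z: "matrix f *v v = f v" for v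
    by (rule fun_cong[OF matrix_vector_mul(2)])
  have fu: "f u = z u" if "u \<in> U" for u
  proof -
    have "f u = (\<Sum>v\<in>U. if v = u then z u else 0)"
      unfolding f_def using U(1) that by (intro sum.cong refl) (auto simp: orthonormal_family_def)
    then show ?thesis
      using fin that by simp
  qed
  have zf: "z u \<bullet> f w = w \<bullet> u" if "u \<in> U" for u w
  proof -
    have "z u \<bullet> f w = (\<Sum>v\<in>U. if v = u then w \<bullet> u else 0)"
      unfolding f_def inner_sum_right
      using z that by (intro sum.cong refl) (auto simp: orthonormal_family_def)
    then show ?thesis
      using fin that by simp
  qed
  have ff: "f v \<bullet> f w = v \<bullet> w" for v w
  proof -
    have "f v \<bullet> f w = (\<Sum>u\<in>U. (v \<bullet> u) * (z u \<bullet> f w))"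
      by (simp add: f_def[of v] inner_sum_left)
    also have "\<dots> = (\<Sum>u\<in>U. (v \<bullet> u) *\<^sub>R u) \<bullet> w"
      unfolding inner_sum_left by (intro sum.cong refl) (simp add: zf inner_commute[of w])
    also have "(\<Sum>u\<in>U. (v \<bullet> u) *\<^sub>R u) = v"
      using orthonormal_set_expand[OF U(1)] U(2) by simp
    finally show ?thesis .
  qed
  have "transpose (matrix f) *v (matrix f *v v) = v" for v
  proof -
    have "\<forall>w. w \<bullet> (transpose (matrix f) *v (matrix f *v v)) = w \<bullet> v"
      unfolding inner_matrix_vector_mult_left[symmetric] Z by (simp add: ff)
    then show ?thesis
      unfolding vector_eq_ldot .
  qed
  then have "matrix f \<in> stiefel"
    by (simp add: stiefel_def matrix_eq matrix_vector_mul_assoc)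
  then show ?thesis
    using that fu Z by metis
qed

section \<open>Critical points and the residual\<close>

text \<open>On the kernel of \<open>B\<close> no invariance under \<open>A\<close> has to be imposed: there the gradient
  reduces to \<open>-ZB(Z\<^sup>TAZu)\<close>, and \<open>Z\<^sup>TAZu\<close> lies in the kernel of \<open>B\<close> because it is orthogonal to
  every basis vector outside the kernel, whose image under \<open>Z\<close> is an eigenvector of \<open>A\<close>.\<close>

lemma critical_point_if_maps_eigenbasis_to_eigenvectors:
  fixes A :: "real^'m^'m" and B :: "real^'n^'n"
  assumes A: "transpose A = A" and B: "transpose B = B"
    and U: "orthonormal_set U" "span U = UNIV"
    and \<beta>: "\<And>u. u \<in> U \<Longrightarrow> B *v u = \<beta> u *\<^sub>R u"
    and Z: "Z \<in> stiefel"
    and \<alpha>: "\<And>u. u \<in> U \<Longrightarrow> \<beta> u \<noteq> 0 \<Longrightarrow> A *v (Z *v u) = \<alpha> u *\<^sub>R (Z *v u)"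
  shows "Z \<in> critical_points (quad_trace A B)"
proof -
  note ZZ = stiefel_transpose_mult[OF Z]
  let ?P = "2 *\<^sub>R (A ** Z ** B) - Z ** transpose Z ** A ** Z ** B - Z ** B ** transpose Z ** A ** Z"
  have P: "?P *v u = 2 *\<^sub>R (A *v (Z *v (B *v u))) - Z *v (transpose Z *v (A *v (Z *v (B *v u))))
      - Z *v (B *v (transpose Z *v (A *v (Z *v u))))" for u
    by (simp add: matrix_vector_mult_diff_rdistrib scaleR_matrix_vector_assoc[symmetric]
        flip: matrix_vector_mul_assoc)
  have "?P *v u = 0" if u: "u \<in> U" for u
  proof (cases "\<beta> u = 0")
    case False
    show ?thesis
      unfolding P using \<beta>[OF u] \<alpha>[OF u False]
      by (simp add: matrix_vector_mult_scaleR ZZ mult.commute flip: scaleR_diff_left)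
  next
    case True
    let ?y = "transpose Z *v (A *v (Z *v u))"
    have "(B *v ?y) \<bullet> v = 0" if v: "v \<in> U" for v
    proof (cases "\<beta> v = 0")
      case True
      then show ?thesis
        using \<beta>[OF v] by (simp add: inner_matrix_vector_mult_left[of B] B)
    next
      case False
      then have "u \<noteq> v"
        using True by auto
      have "?y \<bullet> v = (A *v (Z *v u)) \<bullet> (Z *v v)"
        by (simp add: inner_commute inner_matrix_vector_mult_left[of Z])
      also have "\<dots> = \<alpha> v * (u \<bullet> v)"
        using \<alpha>[OF v False] by (simp add: inner_matrix_vector_mult_left[of A] A stiefel_inner[OF Z])
      also have "\<dots> = 0"
        using orthonormal_familyD(1)[OF U(1) u v] \<open>u \<noteq> v\<close> by simp
      finally show ?thesis
        using \<beta>[OF v] by (simp add: inner_matrix_vector_mult_left[of B] B)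
    qed
    then have "B *v ?y = 0"
      using norm_le_sum_coords[OF U, of "B *v ?y"] by simp
    then show ?thesis
      unfolding P using \<beta>[OF u] True by simp
  qed
  then have "?P = 0"
    by (intro matrix_eq_on_spanning_set[OF U(2)]) simp
  then show ?thesis
    using Z riemannian_grad_quad_trace[OF A B Z] by (simp add: critical_points_def)
qed

text \<open>The two components of the residual: along \<open>X\<close> it is the commutator of \<open>X\<^sup>TAX\<close> and \<open>B\<close>,
  and orthogonally to \<open>X\<close> it measures the failure of the column space of \<open>XB\<close> to be mapped by
  \<open>A\<close> into that of \<open>X\<close>.\<close>

lemma D_rho_components:
  fixes A :: "real^'m^'m" and B :: "real^'n^'n" and X :: "real^'n^'m" and \<rho> :: real
  assumes A: "transpose A = A" and B: "transpose B = B" and X: "X \<in> stiefel"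
  defines "C \<equiv> transpose X ** A ** X" and "D \<equiv> D_rho (quad_trace A B) \<rho> X"
  shows "transpose X ** D = (4 * \<rho>) *\<^sub>R (C ** B - B ** C)"
    and "2 *\<^sub>R (A ** X ** B - X ** C ** B) = D - X ** (transpose X ** D)"
proof -
  define G where "G = 2 *\<^sub>R (A ** X ** B)"
  define M where "M = (2 * \<rho>) *\<^sub>R (transpose G ** X) + (1 - 2 * \<rho>) *\<^sub>R (transpose X ** G)"
  have D: "D = G - X ** M"
    by (simp add: D_def D_rho_def gradient_quad_trace[OF A B] M_def G_def)
  have XX: "transpose X ** (X ** N) = N" for N :: "real^'n^'n"
    using X by (simp add: stiefel_def matrix_mul_assoc)
  have XG: "transpose X ** G = 2 *\<^sub>R (C ** B)"
    by (simp add: G_def C_def matrix_mul_scaleR matrix_mul_assoc)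
  have GX: "transpose G ** X = 2 *\<^sub>R (B ** C)"
    by (simp add: G_def C_def matrix_mul_scaleR matrix_mul_assoc transpose_scalar
        matrix_transpose_mul A B)
  have XD: "transpose X ** D = transpose X ** G - M"
    by (simp add: D matrix_diff_ldistrib XX)
  show "transpose X ** D = (4 * \<rho>) *\<^sub>R (C ** B - B ** C)"
    unfolding XD M_def XG GX by (simp add: algebra_simps)
  show "2 *\<^sub>R (A ** X ** B - X ** C ** B) = D - X ** (transpose X ** D)"
    unfolding XD unfolding D matrix_diff_ldistrib XG
    by (simp add: G_def C_def matrix_mul_scaleR matrix_mul_assoc scaleR_diff_right)
qed

text \<open>Since \<open>[X\<^sup>TAX, B]\<close> is small, \<open>X\<^sup>TAX\<close> is nearly block diagonal with respect to the eigenspaces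
  of \<open>B\<close>. In an eigenbasis of \<open>B\<close> that diagonalises the diagonal blocks as well, which depends on
  \<open>X\<close> while the constant does not, every basis vector \<open>u\<close> is thus nearly an eigenvector of \<open>X\<^sup>TAX\<close>.
  The other component of the residual turns this into a statement about \<open>A\<close> and \<open>Xu\<close>.\<close>

lemma columns_are_approximate_eigenvectors:
  fixes A :: "real^'m^'m" and B :: "real^'n^'n"
  assumes A: "transpose A = A" and B: "transpose B = B" and "\<rho> > 0"
  obtains K where "K > 0"
    "\<And>X :: real^'n^'m. X \<in> stiefel \<Longrightarrow> \<exists>U \<beta>. orthonormal_set U \<and> span U = UNIV \<and>
      (\<forall>u\<in>U. B *v u = \<beta> u *\<^sub>R u) \<and>
      (\<forall>u\<in>U. \<beta> u \<noteq> 0 \<longrightarrow> (\<exists>l. norm (A *v (X *v u) - l *\<^sub>R (X *v u))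
        \<le> K * norm (D_rho (quad_trace A B) \<rho> X)))"
proof -
  have lin: "linear ((*v) M)" for M :: "real^'n^'n"
    by (rule matrix_vector_mul_linear)
  have Badj: "(B *v x) \<bullet> y = x \<bullet> (B *v y)" for x y
    by (simp add: inner_matrix_vector_mult_left B)
  \<comment> \<open>Including \<open>0\<close> makes \<open>g\<close> also a lower bound for the nonzero eigenvalues.\<close>
  obtain g where g: "g > 0"
    "\<And>a b. a \<in> insert 0 {a. \<exists>v. v \<noteq> 0 \<and> B *v v = a *\<^sub>R v} \<Longrightarrow>
      b \<in> insert 0 {a. \<exists>v. v \<noteq> 0 \<and> B *v v = a *\<^sub>R v} \<Longrightarrow> a \<noteq> b \<Longrightarrow> g \<le> \<bar>a - b\<bar>"
    by (rule finite_real_set_gap[OF finite.insertI[OF finite_eigenvalues[OF lin[of B] Badj]], of 0]) blast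
  define K where "K = 1 / g + real CARD('n) / (4 * \<rho> * g)"
  have "K > 0"
    unfolding K_def using g(1) \<open>\<rho> > 0\<close> by (intro add_pos_pos) auto
  moreover have "\<exists>U \<beta>. orthonormal_set U \<and> span U = UNIV \<and>
      (\<forall>u\<in>U. B *v u = \<beta> u *\<^sub>R u) \<and>
      (\<forall>u\<in>U. \<beta> u \<noteq> 0 \<longrightarrow> (\<exists>l. norm (A *v (X *v u) - l *\<^sub>R (X *v u))
        \<le> K * norm (D_rho (quad_trace A B) \<rho> X)))"
    if X: "X \<in> stiefel" for X :: "real^'n^'m"
  proof -
    define C D where "C = transpose X ** A ** X" and "D = D_rho (quad_trace A B) \<rho> X"
    note DC = D_rho_components[OF A B X, of \<rho>, folded C_def D_def]
    have "transpose C = C"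
      by (simp add: C_def matrix_transpose_mul A matrix_mul_assoc)
    then have Cadj: "(C *v x) \<bullet> y = x \<bullet> (C *v y)" for x y
      by (simp add: inner_matrix_vector_mult_left)
    obtain U \<beta> where U: "orthonormal_set U" "span U = UNIV"
      and \<beta>: "\<And>u. u \<in> U \<Longrightarrow> B *v u = \<beta> u *\<^sub>R u"
      and offdiag: "\<And>u v. u \<in> U \<Longrightarrow> v \<in> U \<Longrightarrow> u \<noteq> v \<Longrightarrow> \<beta> u = \<beta> v \<Longrightarrow> v \<bullet> (C *v u) = 0"
      by (rule orthonormal_eigenbasis_adapted[OF lin[of B] Badj lin[of C] Cadj subspace_UNIV subset_UNIV])
        blast
    have card: "card U = CARD('n)"
      using card_orthonormal_basis[OF U] by simp
    have unit: "norm u = 1" if "u \<in> U" for u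
      by (rule orthonormal_familyD(3)[OF U(1) that])
    have eig: "\<beta> u \<in> insert 0 {a. \<exists>v. v \<noteq> 0 \<and> B *v v = a *\<^sub>R v}" if "u \<in> U" for u
    proof -
      have "u \<noteq> 0"
        using unit[OF that] by auto
      then show ?thesis
        using \<beta>[OF that] by blast
    qed
    have Du: "norm (D *v u) \<le> norm D" if "u \<in> U" for u
      using norm_matrix_vector_mult_le[of D u] unit[OF that] by simp
    have "norm (A *v (X *v u) - (u \<bullet> (C *v u)) *\<^sub>R (X *v u)) \<le> K * norm D"
      if u: "u \<in> U" and nz: "\<beta> u \<noteq> 0" for u
    proof -
      define l r where "l = u \<bullet> (C *v u)" and "r = C *v u - l *\<^sub>R u"
      have rv: "\<bar>r \<bullet> v\<bar> \<le> norm D / (4 * \<rho> * g)" if v: "v \<in> U" for v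
      proof (cases "v = u")
        case True
        then have "r \<bullet> v = 0"
          using orthonormal_familyD(2)[OF U(1) u] Cadj[of u u]
          by (simp add: r_def l_def inner_diff_left)
        then show ?thesis
          using g(1) \<open>\<rho> > 0\<close> by simp
      next
        case neq: False
        then have r: "r \<bullet> v = v \<bullet> (C *v u)"
          using orthonormal_familyD(1)[OF U(1) u v]
          by (simp add: r_def inner_diff_left inner_commute[of "C *v u"])
        show ?thesis
        proof (cases "\<beta> u = \<beta> v")
          case True
          then show ?thesis
            using offdiag[OF u v] neq r g(1) \<open>\<rho> > 0\<close> by simp
        next
          case False
          have "(D *v u) \<bullet> (X *v v) = ((transpose X ** D) *v u) \<bullet> v"
            using inner_matrix_vector_mult_left[of X v "D *v u"]
            by (simp add: inner_commute flip: matrix_vector_mul_assoc)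
          also have "\<dots> = 4 * \<rho> * ((\<beta> u - \<beta> v) * (r \<bullet> v))"
            unfolding DC(1) r using \<beta>[OF u] \<beta>[OF v] Badj[of v "C *v u"]
            by (simp add: scaleR_matrix_vector_assoc[symmetric] matrix_vector_mul_assoc[symmetric]
                algebra_simps inner_commute)
          finally have "4 * \<rho> * (\<bar>\<beta> u - \<beta> v\<bar> * \<bar>r \<bullet> v\<bar>) = \<bar>(D *v u) \<bullet> (X *v v)\<bar>"
            using \<open>\<rho> > 0\<close> by (simp add: abs_mult)
          also have "\<dots> \<le> norm (D *v u) * norm (X *v v)"
            by (rule Cauchy_Schwarz_ineq2)
          also have "\<dots> \<le> norm D"
            using Du[OF u] by (simp add: stiefel_norm[OF X] unit[OF v])
          finally have "4 * \<rho> * (\<bar>\<beta> u - \<beta> v\<bar> * \<bar>r \<bullet> v\<bar>) \<le> norm D" .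
          moreover have "g \<le> \<bar>\<beta> u - \<beta> v\<bar>"
            by (rule g(2)[OF eig[OF u] eig[OF v] False])
          then have "4 * \<rho> * (g * \<bar>r \<bullet> v\<bar>) \<le> 4 * \<rho> * (\<bar>\<beta> u - \<beta> v\<bar> * \<bar>r \<bullet> v\<bar>)"
            using \<open>\<rho> > 0\<close> by (intro mult_left_mono mult_right_mono) auto
          ultimately have "\<bar>r \<bullet> v\<bar> * (4 * \<rho> * g) \<le> norm D"
            by (simp add: mult_ac)
          then show ?thesis
            using g(1) \<open>\<rho> > 0\<close> by (simp add: pos_le_divide_eq)
        qed
      qed
      have "norm r \<le> (\<Sum>v\<in>U. norm D / (4 * \<rho> * g))"
        by (rule order_trans[OF norm_le_sum_coords[OF U] sum_mono[OF rv]])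
      then have nr: "norm r \<le> real CARD('n) / (4 * \<rho> * g) * norm D"
        by (simp add: card)
      define e where "e = A *v (X *v u) - X *v (C *v u)"
      have "(2 * \<beta> u) *\<^sub>R e = (2 *\<^sub>R (A ** X ** B - X ** C ** B)) *v u"
        using \<beta>[OF u]
        by (simp add: e_def scaleR_matrix_vector_assoc[symmetric] matrix_vector_mult_diff_rdistrib
            matrix_vector_mul_assoc[symmetric] matrix_vector_mult_scaleR scaleR_diff_right)
      also have "\<dots> = D *v u - X *v (transpose X *v (D *v u))"
        unfolding DC(2) by (simp add: matrix_vector_mult_diff_rdistrib flip: matrix_vector_mul_assoc)
      finally have "norm ((2 * \<beta> u) *\<^sub>R e) \<le> norm (D *v u) + norm (X *v (transpose X *v (D *v u)))"
        by (simp only: norm_triangle_ineq4)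
      also have "\<dots> \<le> 2 * norm D"
        using Du[OF u] stiefel_norm_transpose_le[OF X, of "D *v u"] by (simp add: stiefel_norm[OF X])
      finally have "\<bar>\<beta> u\<bar> * norm e \<le> norm D"
        by (simp add: abs_mult)
      moreover have "g \<le> \<bar>\<beta> u\<bar>"
        using g(2)[OF eig[OF u] insertI1 nz] by simp
      then have "g * norm e \<le> \<bar>\<beta> u\<bar> * norm e"
        by (rule mult_right_mono) simp
      ultimately have "norm e * g \<le> norm D"
        by (simp add: mult.commute)
      then have ne: "norm e \<le> 1 / g * norm D"
        using g(1) by (simp add: pos_le_divide_eq)
      have "A *v (X *v u) - l *\<^sub>R (X *v u) = e + X *v r"
        by (simp add: e_def r_def matrix_vector_mult_diff_distrib matrix_vector_mult_scaleR)
      then have "norm (A *v (X *v u) - l *\<^sub>R (X *v u)) \<le> norm e + norm r"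
        using norm_triangle_ineq[of e "X *v r"] by (simp add: stiefel_norm[OF X])
      also have "\<dots> \<le> K * norm D"
        unfolding K_def distrib_right by (rule add_mono[OF ne nr])
      finally show ?thesis
        by (simp add: l_def)
    qed
    then show ?thesis
      using U \<beta> unfolding D_def by blast
  qed
  ultimately show ?thesis
    by (rule that)
qed

section \<open>The error bound\<close>

lemma critical_point_near_small_residual:
  fixes A :: "real^'m^'m" and B :: "real^'n^'n"
  assumes A: "transpose A = A" and B: "transpose B = B" and "\<rho> > 0"
  obtains \<kappa> where "\<kappa> > 0"
    "\<And>X :: real^'n^'m. X \<in> stiefel \<Longrightarrow> \<kappa> * norm (D_rho (quad_trace A B) \<rho> X) \<le> 1 \<Longrightarrow>
      \<exists>Z \<in> critical_points (quad_trace A B). norm (X - Z) \<le> \<kappa> * norm (D_rho (quad_trace A B) \<rho> X)"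
proof -
  obtain K1 where K1: "K1 > 0"
    "\<And>X :: real^'n^'m. X \<in> stiefel \<Longrightarrow> \<exists>U \<beta>. orthonormal_set U \<and> span U = UNIV \<and>
      (\<forall>u\<in>U. B *v u = \<beta> u *\<^sub>R u) \<and>
      (\<forall>u\<in>U. \<beta> u \<noteq> 0 \<longrightarrow> (\<exists>l. norm (A *v (X *v u) - l *\<^sub>R (X *v u))
        \<le> K1 * norm (D_rho (quad_trace A B) \<rho> X)))"
    using columns_are_approximate_eigenvectors[OF A B \<open>\<rho> > 0\<close>] by blast
  have Aadj: "(A *v x) \<bullet> y = x \<bullet> (A *v y)" for x y
    by (simp add: inner_matrix_vector_mult_left A)
  obtain K2 where K2: "K2 > 0"
    "\<And>x l. \<exists>a y. A *v y = a *\<^sub>R y \<and> norm (x - y) \<le> K2 * norm (A *v x - l *\<^sub>R x)"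
    using approximate_eigenvector_near_eigenvector[OF matrix_vector_mul_linear Aadj] by metis
  define G N where "G = gram_schmidt_const CARD('n)" and "N = real (CARD('m) * CARD('n) * CARD('n))"
  have G: "G > 0"
    unfolding G_def by (rule gram_schmidt_const_pos)
  have "N \<ge> 1"
    unfolding N_def by (simp add: Suc_le_eq del: of_nat_mult)
  define \<kappa> where "\<kappa> = N * (G * (K2 * K1))"
  have "\<kappa> > 0"
    unfolding \<kappa>_def using G K1(1) K2(1) \<open>N \<ge> 1\<close> by simp
  moreover have "\<exists>Z \<in> critical_points (quad_trace A B). norm (X - Z) \<le> \<kappa> * norm (D_rho (quad_trace A B) \<rho> X)"
    if X: "X \<in> stiefel" and small: "\<kappa> * norm (D_rho (quad_trace A B) \<rho> X) \<le> 1" for X :: "real^'n^'m"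
  proof -
    define d where "d = norm (D_rho (quad_trace A B) \<rho> X)"
    have d: "0 \<le> d"
      by (simp add: d_def)
    obtain U \<beta> where U: "orthonormal_set U" "span U = UNIV"
      and \<beta>: "\<And>u. u \<in> U \<Longrightarrow> B *v u = \<beta> u *\<^sub>R u"
      and approx: "\<And>u. u \<in> U \<Longrightarrow> \<beta> u \<noteq> 0 \<Longrightarrow>
        \<exists>l. norm (A *v (X *v u) - l *\<^sub>R (X *v u)) \<le> K1 * d"
      using K1(2)[OF X] unfolding d_def by blast
    have card: "card U = CARD('n)"
      using card_orthonormal_basis[OF U] by simp
    define \<epsilon> where "\<epsilon> = K2 * K1 * d"
    have \<epsilon>: "0 \<le> \<epsilon>"
      unfolding \<epsilon>_def using K1(1) K2(1) d by simp
    have "\<exists>a y. A *v y = a *\<^sub>R y \<and> norm (X *v u - y) \<le> \<epsilon>" if u: "u \<in> U" "\<beta> u \<noteq> 0" for u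
    proof -
      obtain l where "norm (A *v (X *v u) - l *\<^sub>R (X *v u)) \<le> K1 * d"
        using approx[OF u] by blast
      then have "K2 * norm (A *v (X *v u) - l *\<^sub>R (X *v u)) \<le> \<epsilon>"
        unfolding \<epsilon>_def using K2(1) by (simp add: mult.assoc)
      then show ?thesis
        using K2(2)[of "X *v u" l] by (meson order_trans)
    qed
    then have "\<forall>u \<in> {u \<in> U. \<beta> u \<noteq> 0}. \<exists>p. A *v snd p = fst p *\<^sub>R snd p \<and> norm (X *v u - snd p) \<le> \<epsilon>"
      by auto
    from bchoice[OF this] obtain p where p: "\<And>u. u \<in> U \<Longrightarrow> \<beta> u \<noteq> 0 \<Longrightarrow>
        A *v snd (p u) = fst (p u) *\<^sub>R snd (p u) \<and> norm (X *v u - snd (p u)) \<le> \<epsilon>"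
      by blast
    define \<alpha> y where "\<alpha> u = fst (p u)" and "y u = (if \<beta> u = 0 then X *v u else snd (p u))" for u
    define V where "V u = (if \<beta> u = 0 then UNIV else {v. A *v v = \<alpha> u *\<^sub>R v})" for u
    \<comment> \<open>The unconstrained columns come last, as they can be made orthogonal to all the others.\<close>
    define r :: "real^'n \<Rightarrow> nat" where "r u = (if \<beta> u = 0 then 1 else 0)" for u
    obtain z where z: "orthonormal_family z U"
      "\<And>u. u \<in> U \<Longrightarrow> z u \<in> V u \<and> norm (X *v u - z u) \<le> gram_schmidt_const (card U) * \<epsilon>"
    proof (rule orthonormal_family_in_subspaces[of U "\<lambda>u. X *v u" V r y \<epsilon>])
      show "finite U"
        by (rule orthonormal_set_imp_finite[OF U(1)])
      show "orthonormal_family (\<lambda>u. X *v u) U"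
        by (rule stiefel_orthonormal_family[OF X U(1)])
      show "subspace (V u)" for u
        by (auto simp: V_def subspace_def matrix_vector_right_distrib matrix_vector_mult_scaleR
            scaleR_add_right)
      show "V j \<subseteq> V i \<or> (\<forall>a\<in>V j. \<forall>b\<in>V i. a \<bullet> b = 0)" if "r j \<le> r i" for i j
      proof (cases "\<beta> i = 0 \<or> \<alpha> i = \<alpha> j")
        case True
        then show ?thesis
          using that by (auto simp: V_def r_def split: if_splits)
      next
        case False
        have "a \<bullet> b = 0" if "A *v a = \<alpha> j *\<^sub>R a" "A *v b = \<alpha> i *\<^sub>R b" for a b
        proof -
          have "\<alpha> j * (a \<bullet> b) = \<alpha> i * (a \<bullet> b)"
            using Aadj[of a b] that by simp
          then show ?thesis
            using False by simp
        qed
        then show ?thesis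
          using False that by (auto simp: V_def r_def split: if_splits)
      qed
      show "y u \<in> V u \<and> norm (X *v u - y u) \<le> \<epsilon>" if "u \<in> U" for u
        using p[OF that] \<epsilon> by (simp add: y_def V_def \<alpha>_def)
      have "1 * (G * (K2 * K1)) \<le> \<kappa>"
        unfolding \<kappa>_def using G K1(1) K2(1) \<open>N \<ge> 1\<close> by (intro mult_right_mono) auto
      then have "G * (K2 * K1) * d \<le> \<kappa> * d"
        using d by (intro mult_right_mono) auto
      then show "gram_schmidt_const (card U) * \<epsilon> \<le> 1"
        using small by (simp add: card G_def \<epsilon>_def d_def mult.assoc)
    qed (use \<epsilon> in auto)
    obtain Z where Z: "Z \<in> stiefel" "\<And>u. u \<in> U \<Longrightarrow> Z *v u = z u"
      using stiefel_matrix_mapping_basis[OF U z(1)] by blast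
    have "Z \<in> critical_points (quad_trace A B)"
    proof (rule critical_point_if_maps_eigenbasis_to_eigenvectors[OF A B U \<beta> Z(1)])
      show "A *v (Z *v u) = \<alpha> u *\<^sub>R (Z *v u)" if "u \<in> U" "\<beta> u \<noteq> 0" for u
        using z(2)[OF that(1)] Z(2)[OF that(1)] that(2) by (simp add: V_def)
    qed
    moreover have "norm (X - Z) \<le> \<kappa> * d"
    proof -
      have "norm (X - Z) \<le> real (CARD('m) * CARD('n)) * (\<Sum>u\<in>U. norm ((X - Z) *v u))"
        by (rule norm_matrix_le_sum_on_basis[OF U])
      also have "\<dots> \<le> real (CARD('m) * CARD('n)) * (\<Sum>u\<in>U. G * \<epsilon>)"
        using z(2) Z(2)
        by (intro mult_left_mono sum_mono) (auto simp: matrix_vector_mult_diff_rdistrib card G_def)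
      also have "\<dots> = \<kappa> * d"
        by (simp add: card \<kappa>_def \<epsilon>_def N_def)
      finally show ?thesis .
    qed
    ultimately show ?thesis
      unfolding d_def by blast
  qed
  ultimately show ?thesis
    by (rule that)
qed

theorem theorem2:
  fixes A :: "real^'m^'m" and B :: "real^'n^'n" and \<rho> :: real
  assumes "CARD('n) \<le> CARD('m)"
    and "transpose A = A" and "transpose B = B"
    and "\<rho> > 0"
  shows "\<exists>\<delta> > 0. \<exists>\<eta> > 0. \<forall>X :: real^'n^'m.
           X \<in> stiefel \<longrightarrow> infdist X (critical_points (quad_trace A B)) \<le> \<delta> \<longrightarrow>
           infdist X (critical_points (quad_trace A B)) \<le> \<eta> * norm (D_rho (quad_trace A B) \<rho> X)"
proof -
  obtain \<kappa> where \<kappa>: "\<kappa> > 0"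
    "\<And>X :: real^'n^'m. X \<in> stiefel \<Longrightarrow> \<kappa> * norm (D_rho (quad_trace A B) \<rho> X) \<le> 1 \<Longrightarrow>
      \<exists>Z \<in> critical_points (quad_trace A B). norm (X - Z) \<le> \<kappa> * norm (D_rho (quad_trace A B) \<rho> X)"
    using critical_point_near_small_residual[OF assms(2-4)] by blast
  have "infdist X (critical_points (quad_trace A B)) \<le> \<kappa> * norm (D_rho (quad_trace A B) \<rho> X)"
    if X: "X \<in> stiefel" and le: "infdist X (critical_points (quad_trace A B)) \<le> 1"
    for X :: "real^'n^'m"
  proof (cases "\<kappa> * norm (D_rho (quad_trace A B) \<rho> X) \<le> 1")
    case True
    with \<kappa>(2)[OF X] obtain Z where "Z \<in> critical_points (quad_trace A B)"
      "dist X Z \<le> \<kappa> * norm (D_rho (quad_trace A B) \<rho> X)"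
      unfolding dist_norm by blast
    then show ?thesis
      by (rule infdist_le2)
  next
    case False
    then show ?thesis
      using le by linarith
  qed
  then have bound: "\<exists>\<eta> > 0. \<forall>X :: real^'n^'m. X \<in> stiefel \<longrightarrow>
      infdist X (critical_points (quad_trace A B)) \<le> 1 \<longrightarrow>
      infdist X (critical_points (quad_trace A B)) \<le> \<eta> * norm (D_rho (quad_trace A B) \<rho> X)"
    using \<kappa>(1) by blast
  show ?thesis
  proof (rule exI, rule conjI)
    show "(0::real) < 1"
      by simp
  qed (rule bound)
qed

end
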